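(* Let $A$ be an algebra with identity over a ground ring $K$, let $e\in A$ be an idempotent, and let $S$ be a submodule of the left regular module of $eAe$ (that is, a left ideal of $eAe$), and suppose that $S$ has a basis $D$ over $K$. Let $G(S)=Ae\otimes_{eAe}S$. Then the set $e\otimes D=\{e\otimes d: d\in D\}$ is linearly independent in $G(S)$ and generates $G(S)$ as a left $A$-module. Further, $$G(S)\stackrel{\mu}{\twoheadrightarrow} AS\hookrightarrow G(eAe)\cong Ae\hookrightarrow A$$ as left $A$-modules, where $\mu$ is the (surjective) multiplication map $ae\otimes s\mapsto aes$.
   Context: $G$ is the globalisation functor from left $eAe$-modules to left $A$-modules, $G(M)=Ae\otimes_{eAe}M$. In particular $G(eAe)=Ae\otimes_{eAe}eAe\cong Ae$ by multiplication. $AS=AeS$ denotes the left $A$-submodule of $A$ generated by $S$; since $S\subset eAe$ it lies in $Ae$, and the map $AS\hookrightarrow G(eAe)$ is this inclusion followed by the inverse of the isomorphism $G(eAe)\cong Ae$. *)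

theory Defs
  imports "HOL-Algebra.Free_Abelian_Groups" "HOL-Algebra.Generated_Groups" "HOL-Algebra.Module"
begin

(* The library's locales module and algebra require a commutative base ring and a commutative
   algebra, respectively; the next locales are the versions for not necessarily commutative rings. *)

locale left_module = R?: ring R + M?: abelian_group M
  for R :: "('a, 'q) ring_scheme" (structure) and M :: "('a, 'b, 'n) module_scheme" (structure) +
  assumes smult_closed [simp, intro]:
      "\<lbrakk>a \<in> carrier R; x \<in> carrier M\<rbrakk> \<Longrightarrow> a \<odot>\<^bsub>M\<^esub> x \<in> carrier M"
    and smult_l_distr:
      "\<lbrakk>a \<in> carrier R; b \<in> carrier R; x \<in> carrier M\<rbrakk> \<Longrightarrow>
        (a \<oplus>\<^bsub>R\<^esub> b) \<odot>\<^bsub>M\<^esub> x = a \<odot>\<^bsub>M\<^esub> x \<oplus>\<^bsub>M\<^esub> b \<odot>\<^bsub>M\<^esub> x"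
    and smult_r_distr:
      "\<lbrakk>a \<in> carrier R; x \<in> carrier M; y \<in> carrier M\<rbrakk> \<Longrightarrow>
        a \<odot>\<^bsub>M\<^esub> (x \<oplus>\<^bsub>M\<^esub> y) = a \<odot>\<^bsub>M\<^esub> x \<oplus>\<^bsub>M\<^esub> a \<odot>\<^bsub>M\<^esub> y"
    and smult_assoc:
      "\<lbrakk>a \<in> carrier R; b \<in> carrier R; x \<in> carrier M\<rbrakk> \<Longrightarrow>
        (a \<otimes>\<^bsub>R\<^esub> b) \<odot>\<^bsub>M\<^esub> x = a \<odot>\<^bsub>M\<^esub> (b \<odot>\<^bsub>M\<^esub> x)"
    and smult_one [simp]: "x \<in> carrier M \<Longrightarrow> \<one>\<^bsub>R\<^esub> \<odot>\<^bsub>M\<^esub> x = x"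

locale left_module_hom = M: left_module R M + N: left_module R N
  for R :: "('a, 'q) ring_scheme" (structure)
    and M :: "('a, 'b, 'n) module_scheme" and N :: "('a, 'c, 'p) module_scheme"
    and h :: "'b \<Rightarrow> 'c" +
  assumes hom_closed: "x \<in> carrier M \<Longrightarrow> h x \<in> carrier N"
    and hom_add: "\<lbrakk>x \<in> carrier M; y \<in> carrier M\<rbrakk> \<Longrightarrow> h (x \<oplus>\<^bsub>M\<^esub> y) = h x \<oplus>\<^bsub>N\<^esub> h y"
    and hom_smult: "\<lbrakk>a \<in> carrier R; x \<in> carrier M\<rbrakk> \<Longrightarrow> h (a \<odot>\<^bsub>M\<^esub> x) = a \<odot>\<^bsub>N\<^esub> h x"

locale unital_algebra = module K A + ring A
  for K :: "('k, 'q) ring_scheme" (structure) and A :: "('k, 'a) module" (structure) +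
  assumes smult_mult_left:
      "\<lbrakk>k \<in> carrier K; x \<in> carrier A; y \<in> carrier A\<rbrakk> \<Longrightarrow>
        (k \<odot>\<^bsub>A\<^esub> x) \<otimes>\<^bsub>A\<^esub> y = k \<odot>\<^bsub>A\<^esub> (x \<otimes>\<^bsub>A\<^esub> y)"
    and smult_mult_right:
      "\<lbrakk>k \<in> carrier K; x \<in> carrier A; y \<in> carrier A\<rbrakk> \<Longrightarrow>
        x \<otimes>\<^bsub>A\<^esub> (k \<odot>\<^bsub>A\<^esub> y) = k \<odot>\<^bsub>A\<^esub> (x \<otimes>\<^bsub>A\<^esub> y)"

definition submodule_span ::
    "('r, 'q) ring_scheme \<Rightarrow> ('r, 'm) module \<Rightarrow> 'm set \<Rightarrow> 'm set"
  where "submodule_span R M V = \<Inter>{N. submodule N R M \<and> V \<subseteq> N}"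

definition lin_independent ::
    "('r, 'q) ring_scheme \<Rightarrow> ('r, 'm) module \<Rightarrow> 'm set \<Rightarrow> bool"
  where "lin_independent R M D \<longleftrightarrow> D \<subseteq> carrier M \<and>
    (\<forall>F c. finite F \<longrightarrow> F \<subseteq> D \<longrightarrow> c \<in> F \<rightarrow> carrier R \<longrightarrow>
      (\<Oplus>\<^bsub>M\<^esub>d\<in>F. c d \<odot>\<^bsub>M\<^esub> d) = \<zero>\<^bsub>M\<^esub> \<longrightarrow> (\<forall>d\<in>F. c d = \<zero>\<^bsub>R\<^esub>))"

definition is_basis :: "('r, 'q) ring_scheme \<Rightarrow> ('r, 'm) module \<Rightarrow> 'm set \<Rightarrow> bool"
  where "is_basis R M D \<longleftrightarrow> lin_independent R M D \<and> submodule_span R M D = carrier M"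

definition left_regular :: "('a, 'q) ring_scheme \<Rightarrow> ('a, 'a) module"
  where "left_regular R = \<lparr>carrier = carrier R, mult = mult R, one = one R,
    zero = zero R, add = add R, smult = mult R\<rparr>"

definition left_ideal_module :: "('a, 'q) ring_scheme \<Rightarrow> 'a set \<Rightarrow> ('a, 'a) module"
  where "left_ideal_module R S = (left_regular R)\<lparr>carrier := S\<rparr>"

(* The K-module underlying a left module over a K-algebra A: k acts as k.1_A. *)
definition restrict_scalars ::
    "('k, 'a) module \<Rightarrow> ('a, 'm) module \<Rightarrow> ('k, 'm) module"
  where "restrict_scalars A M = \<lparr>carrier = carrier M, mult = mult M, one = one M,
    zero = zero M, add = add M, smult = (\<lambda>k m. (k \<odot>\<^bsub>A\<^esub> \<one>\<^bsub>A\<^esub>) \<odot>\<^bsub>M\<^esub> m)\<rparr>"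

definition corner :: "('k, 'a) module \<Rightarrow> 'a \<Rightarrow> ('k, 'a) module"
  where "corner A e = A\<lparr>carrier := {e \<otimes>\<^bsub>A\<^esub> a \<otimes>\<^bsub>A\<^esub> e |a. a \<in> carrier A}, one := e\<rparr>"

definition left_ideal_Ae :: "('k, 'a) module \<Rightarrow> 'a \<Rightarrow> ('a, 'a) module"
  where "left_ideal_Ae A e = left_ideal_module A {a \<otimes>\<^bsub>A\<^esub> e |a. a \<in> carrier A}"

definition generated_left_ideal :: "('k, 'a) module \<Rightarrow> 'a set \<Rightarrow> ('a, 'a) module"
  where "generated_left_ideal A S = left_ideal_module A (submodule_span A (left_regular A) S)"

(* Tensor product over R of V (a left module with a commuting right R-action ract) and a left
   R-module M: the free abelian group on carrier V x carrier M modulo the subgroup generated by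
   the bilinearity and balancing relations. Elements are cosets; as a record, the unused ring
   fields mult and one are left undefined. *)

definition tensor_relations ::
    "('a, 'x) module \<Rightarrow> ('x \<Rightarrow> 'r \<Rightarrow> 'x) \<Rightarrow> ('r, 'q) ring_scheme \<Rightarrow> ('r, 'm) module \<Rightarrow>
      ('x \<times> 'm \<Rightarrow>\<^sub>0 int) set"
  where "tensor_relations V ract R M =
    {frag_of (x \<oplus>\<^bsub>V\<^esub> y, m) - frag_of (x, m) - frag_of (y, m) |x y m.
      x \<in> carrier V \<and> y \<in> carrier V \<and> m \<in> carrier M} \<union>
    {frag_of (x, m \<oplus>\<^bsub>M\<^esub> n) - frag_of (x, m) - frag_of (x, n) |x m n.
      x \<in> carrier V \<and> m \<in> carrier M \<and> n \<in> carrier M} \<union>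
    {frag_of (ract x r, m) - frag_of (x, r \<odot>\<^bsub>M\<^esub> m) |x r m.
      x \<in> carrier V \<and> r \<in> carrier R \<and> m \<in> carrier M}"

definition tensor_null ::
    "('a, 'x) module \<Rightarrow> ('x \<Rightarrow> 'r \<Rightarrow> 'x) \<Rightarrow> ('r, 'q) ring_scheme \<Rightarrow> ('r, 'm) module \<Rightarrow>
      ('x \<times> 'm \<Rightarrow>\<^sub>0 int) set"
  where "tensor_null V ract R M =
    generate (free_Abelian_group (carrier V \<times> carrier M)) (tensor_relations V ract R M)"

definition pure_tensor ::
    "('a, 'x) module \<Rightarrow> ('x \<Rightarrow> 'r \<Rightarrow> 'x) \<Rightarrow> ('r, 'q) ring_scheme \<Rightarrow> ('r, 'm) module \<Rightarrow>
      'x \<Rightarrow> 'm \<Rightarrow> ('x \<times> 'm \<Rightarrow>\<^sub>0 int) set"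
  where "pure_tensor V ract R M x m =
    tensor_null V ract R M #>\<^bsub>free_Abelian_group (carrier V \<times> carrier M)\<^esub> frag_of (x, m)"

definition tensor_product ::
    "('a, 'x) module \<Rightarrow> ('x \<Rightarrow> 'r \<Rightarrow> 'x) \<Rightarrow> ('r, 'q) ring_scheme \<Rightarrow> ('r, 'm) module \<Rightarrow>
      ('a, ('x \<times> 'm \<Rightarrow>\<^sub>0 int) set) module"
  where "tensor_product V ract R M =
    (let F = free_Abelian_group (carrier V \<times> carrier M);
         N = tensor_null V ract R M
     in \<lparr>carrier = carrier (F Mod N), mult = undefined, one = undefined,
         zero = one (F Mod N), add = mult (F Mod N),
         smult = (\<lambda>a C. \<Union>c\<in>C. N #>\<^bsub>F\<^esub> frag_extend (\<lambda>(x, m). frag_of (a \<odot>\<^bsub>V\<^esub> x, m)) c)\<rparr>)"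

definition globalisation ::
    "('k, 'a) module \<Rightarrow> 'a \<Rightarrow> ('a, 'm) module \<Rightarrow> ('a, ('a \<times> 'm \<Rightarrow>\<^sub>0 int) set) module"
  where "globalisation A e M = tensor_product (left_ideal_Ae A e) (mult A) (corner A e) M"

definition glob_tensor ::
    "('k, 'a) module \<Rightarrow> 'a \<Rightarrow> ('a, 'm) module \<Rightarrow> 'a \<Rightarrow> 'm \<Rightarrow> ('a \<times> 'm \<Rightarrow>\<^sub>0 int) set"
  where "glob_tensor A e M = pure_tensor (left_ideal_Ae A e) (mult A) (corner A e) M"

end

theory Submission
  imports Defs
begin

text \<open>
  Everything rests on the multiplication map \<open>\<mu> : Ae \<otimes> S \<rightarrow> A\<close>, \<open>x \<otimes> s \<mapsto> x s\<close>, which exists for every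
  left ideal \<open>S\<close> of \<open>eAe\<close> by the universal property of the tensor product (\<open>multiplication_hom\<close>).
  Its image is a submodule that contains \<open>s = e s\<close> for each \<open>s\<close> in \<open>S\<close> and is generated additively by
  the products \<open>x s\<close>, so it is \<open>AS\<close> (\<open>image_multiplication\<close>).

  For \<open>S = eAe\<close> the image is \<open>Ae\<close>, and \<open>\<mu>\<close> is injective: balancing gives \<open>x \<otimes> y = x y \<otimes> e\<close> for \<open>y\<close> in
  \<open>eAe\<close>, so that \<open>x \<mapsto> x \<otimes> e\<close>, from \<open>Ae\<close>, is its two-sided inverse (\<open>multiplication_eAe_section\<close>).
  Restricting this inverse to \<open>AS \<subseteq> Ae\<close> embeds \<open>AS\<close> into the globalisation of \<open>eAe\<close>.

  As for the basis \<open>D\<close> of \<open>S\<close> (\<open>pure_e_basis\<close>): \<open>\<mu> (e \<otimes> d) = e d = d\<close>, so \<open>\<mu>\<close> takes a linear relation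
  among the \<open>e \<otimes> d\<close> to the same relation among the \<open>d\<close>, which is trivial. On the other hand
  \<open>s \<mapsto> e \<otimes> s\<close> is \<open>K\<close>-linear, so a submodule that contains \<open>e \<otimes> D\<close> contains \<open>e \<otimes> s\<close> for every \<open>s\<close> in \<open>S\<close>,
  hence every \<open>x \<otimes> s = x (e \<otimes> s)\<close>, and these generate the tensor product.
\<close>

section \<open>Left modules and linear independence\<close>

lemma (in module) is_left_module: "left_module R M"
  by unfold_locales (auto simp: smult_l_distr smult_r_distr smult_assoc1)

context left_module
begin

lemma smult_l_zero: "x \<in> carrier M \<Longrightarrow> \<zero>\<^bsub>R\<^esub> \<odot>\<^bsub>M\<^esub> x = \<zero>\<^bsub>M\<^esub>"
  using smult_l_distr[of "\<zero>\<^bsub>R\<^esub>" "\<zero>\<^bsub>R\<^esub>" x]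
  by (metis M.add.l_cancel_one R.l_zero R.zero_closed smult_closed)

lemma smult_minus_one: "x \<in> carrier M \<Longrightarrow> (\<ominus>\<^bsub>R\<^esub> \<one>\<^bsub>R\<^esub>) \<odot>\<^bsub>M\<^esub> x = \<ominus>\<^bsub>M\<^esub> x"
  using smult_l_distr[of "\<ominus>\<^bsub>R\<^esub> \<one>\<^bsub>R\<^esub>" "\<one>\<^bsub>R\<^esub>" x]
  by (metis M.minus_equality R.add.inv_closed R.l_neg R.one_closed smult_closed smult_l_zero smult_one)

lemma smult_r_zero: "a \<in> carrier R \<Longrightarrow> a \<odot>\<^bsub>M\<^esub> \<zero>\<^bsub>M\<^esub> = \<zero>\<^bsub>M\<^esub>"
  using smult_r_distr[of a "\<zero>\<^bsub>M\<^esub>" "\<zero>\<^bsub>M\<^esub>"]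
  by (metis M.add.l_cancel_one M.l_zero M.zero_closed smult_closed)

lemma smult_r_diff:
  assumes "a \<in> carrier R" "x \<in> carrier M" "y \<in> carrier M"
  shows "a \<odot>\<^bsub>M\<^esub> (x \<ominus>\<^bsub>M\<^esub> y) = a \<odot>\<^bsub>M\<^esub> x \<ominus>\<^bsub>M\<^esub> a \<odot>\<^bsub>M\<^esub> y"
proof -
  have "a \<odot>\<^bsub>M\<^esub> (\<ominus>\<^bsub>M\<^esub> y) \<oplus>\<^bsub>M\<^esub> a \<odot>\<^bsub>M\<^esub> y = \<zero>\<^bsub>M\<^esub>"
    using assms smult_r_distr[of a "\<ominus>\<^bsub>M\<^esub> y" y] by (simp add: M.l_neg smult_r_zero)
  then have "a \<odot>\<^bsub>M\<^esub> (\<ominus>\<^bsub>M\<^esub> y) = \<ominus>\<^bsub>M\<^esub> (a \<odot>\<^bsub>M\<^esub> y)"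
    using assms by (metis M.add.inv_closed M.minus_equality smult_closed)
  then show ?thesis
    using assms by (simp add: a_minus_def smult_r_distr)
qed

text \<open>Closure under negatives comes from the scalar \<open>-1\<close>.\<close>

lemma submoduleI:
  assumes "H \<subseteq> carrier M" "\<zero>\<^bsub>M\<^esub> \<in> H"
    and "\<And>x y. \<lbrakk>x \<in> H; y \<in> H\<rbrakk> \<Longrightarrow> x \<oplus>\<^bsub>M\<^esub> y \<in> H"
    and "\<And>a x. \<lbrakk>a \<in> carrier R; x \<in> H\<rbrakk> \<Longrightarrow> a \<odot>\<^bsub>M\<^esub> x \<in> H"
  shows "submodule H R M"
proof -
  have "\<ominus>\<^bsub>M\<^esub> x \<in> H" if "x \<in> H" for x
    using that assms(1,4) smult_minus_one by (metis R.add.inv_closed R.one_closed subsetD)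
  then show ?thesis
    using assms
    by (intro submodule.intro subgroup.intro) (auto simp: submodule_axioms_def a_inv_def)
qed

lemma submoduleD:
  assumes "submodule H R M"
  shows "H \<subseteq> carrier M" "\<zero>\<^bsub>M\<^esub> \<in> H"
    and "\<And>x y. \<lbrakk>x \<in> H; y \<in> H\<rbrakk> \<Longrightarrow> x \<oplus>\<^bsub>M\<^esub> y \<in> H"
    and "\<And>x. x \<in> H \<Longrightarrow> \<ominus>\<^bsub>M\<^esub> x \<in> H"
    and "\<And>a x. \<lbrakk>a \<in> carrier R; x \<in> H\<rbrakk> \<Longrightarrow> a \<odot>\<^bsub>M\<^esub> x \<in> H"
proof -
  interpret submodule H R M by fact
  show "H \<subseteq> carrier M" using subset by simp
  show "\<zero>\<^bsub>M\<^esub> \<in> H" using one_closed by simp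
  show "\<And>x y. \<lbrakk>x \<in> H; y \<in> H\<rbrakk> \<Longrightarrow> x \<oplus>\<^bsub>M\<^esub> y \<in> H" using m_closed by simp
  show "\<And>x. x \<in> H \<Longrightarrow> \<ominus>\<^bsub>M\<^esub> x \<in> H" using m_inv_closed by (simp add: a_inv_def)
  show "\<And>a x. \<lbrakk>a \<in> carrier R; x \<in> H\<rbrakk> \<Longrightarrow> a \<odot>\<^bsub>M\<^esub> x \<in> H" by blast
qed

lemma carrier_submodule: "submodule (carrier M) R M"
  by (rule submoduleI) auto

lemma left_module_submodule:
  assumes "submodule H R M"
  shows "left_module R (M\<lparr>carrier := H\<rparr>)"
proof -
  note H = submoduleD[OF assms]
  have in_M: "x \<in> carrier M" if "x \<in> H" for x
    using that H(1) by blast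
  have "abelian_group (M\<lparr>carrier := H\<rparr>)"
  proof (rule abelian_groupI)
    show "\<exists>y\<in>carrier (M\<lparr>carrier := H\<rparr>). y \<oplus>\<^bsub>M\<lparr>carrier := H\<rparr>\<^esub> x = \<zero>\<^bsub>M\<lparr>carrier := H\<rparr>\<^esub>"
      if "x \<in> carrier (M\<lparr>carrier := H\<rparr>)" for x
      using that H(4) in_M by (auto intro!: bexI[of _ "\<ominus>\<^bsub>M\<^esub> x"] M.l_neg)
  qed (use H(2,3) in_M in \<open>auto simp: M.a_assoc intro: M.a_comm\<close>)
  then interpret H: abelian_group "M\<lparr>carrier := H\<rparr>" .
  show ?thesis
    by unfold_locales
      (use H(5) in_M in \<open>auto simp: smult_l_distr smult_r_distr smult_assoc\<close>)
qed

end

lemma submodule_span_least: "\<lbrakk>submodule N R M; V \<subseteq> N\<rbrakk> \<Longrightarrow> submodule_span R M V \<subseteq> N"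
  unfolding submodule_span_def by blast

lemma submodule_span_base: "v \<in> V \<Longrightarrow> v \<in> submodule_span R M V"
  unfolding submodule_span_def by blast

lemma submodule_submodule_span:
  assumes "left_module R M" "V \<subseteq> carrier M"
  shows "submodule (submodule_span R M V) R M"
proof -
  interpret left_module R M by fact
  show ?thesis
  proof (rule submoduleI)
    show "submodule_span R M V \<subseteq> carrier M"
      using assms(2) carrier_submodule unfolding submodule_span_def by blast
  qed (auto simp: submodule_span_def submoduleD)
qed

context left_module_hom
begin

lemma hom_zero: "h \<zero>\<^bsub>M\<^esub> = \<zero>\<^bsub>N\<^esub>"
  using hom_smult[of "\<zero>\<^bsub>R\<^esub>" "\<zero>\<^bsub>M\<^esub>"]
  by (simp add: M.smult_l_zero N.smult_l_zero hom_closed)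

lemma hom_minus: "x \<in> carrier M \<Longrightarrow> h (\<ominus>\<^bsub>M\<^esub> x) = \<ominus>\<^bsub>N\<^esub> h x"
  by (metis M.R.add.inv_closed M.R.one_closed M.smult_minus_one N.smult_minus_one hom_closed hom_smult)

lemma hom_diff: "\<lbrakk>x \<in> carrier M; y \<in> carrier M\<rbrakk> \<Longrightarrow> h (x \<ominus>\<^bsub>M\<^esub> y) = h x \<ominus>\<^bsub>N\<^esub> h y"
  by (simp add: a_minus_def hom_add hom_minus)

lemma hom_finsum:
  "f \<in> F \<rightarrow> carrier M \<Longrightarrow> h (\<Oplus>\<^bsub>M\<^esub>i\<in>F. f i) = (\<Oplus>\<^bsub>N\<^esub>i\<in>F. h (f i))"
  by (induction F rule: infinite_finite_induct)
    (auto simp: hom_zero hom_add hom_closed Pi_iff)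

lemma image_submodule:
  assumes "submodule H R M"
  shows "submodule (h ` H) R N"
proof -
  note H = M.submoduleD[OF assms]
  show ?thesis
  proof (rule N.submoduleI)
    show "h ` H \<subseteq> carrier N" using H(1) hom_closed by auto
    show "\<zero>\<^bsub>N\<^esub> \<in> h ` H" using H(2) hom_zero by (metis imageI)
    show "u \<oplus>\<^bsub>N\<^esub> v \<in> h ` H" if u: "u \<in> h ` H" and v: "v \<in> h ` H" for u v
    proof -
      obtain x y where xy: "x \<in> H" "y \<in> H" "u = h x" "v = h y"
        using u v by auto
      then have "u \<oplus>\<^bsub>N\<^esub> v = h (x \<oplus>\<^bsub>M\<^esub> y)" using H(1) by (auto simp: hom_add subset_iff)
      then show ?thesis using xy H(3) by auto
    qed
    show "a \<odot>\<^bsub>N\<^esub> u \<in> h ` H" if a: "a \<in> carrier R" and u: "u \<in> h ` H" for a u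
    proof -
      obtain x where x: "x \<in> H" "u = h x" using u by auto
      then have "a \<odot>\<^bsub>N\<^esub> u = h (a \<odot>\<^bsub>M\<^esub> x)" using a H(1) by (auto simp: hom_smult subset_iff)
      then show ?thesis using a x H(5) by auto
    qed
  qed
qed

lemma preimage_submodule:
  assumes "submodule H R N"
  shows "submodule {x \<in> carrier M. h x \<in> H} R M"
  using N.submoduleD[OF assms]
  by (intro M.submoduleI) (auto simp: hom_zero hom_add hom_smult)

lemma hom_into_submodule:
  assumes "submodule H R N" "h ` carrier M \<subseteq> H"
  shows "left_module_hom R M (N\<lparr>carrier := H\<rparr>) h"
proof -
  interpret H: left_module R "N\<lparr>carrier := H\<rparr>" by (rule N.left_module_submodule) fact
  show ?thesis
    by unfold_locales (use assms(2) in \<open>auto simp: hom_add hom_smult\<close>)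
qed

lemma hom_restrict:
  assumes "submodule H R M"
  shows "left_module_hom R (M\<lparr>carrier := H\<rparr>) N h"
proof -
  interpret H: left_module R "M\<lparr>carrier := H\<rparr>" by (rule M.left_module_submodule) fact
  show ?thesis
    by unfold_locales
      (use M.submoduleD(1)[OF assms] in \<open>auto simp: subset_iff hom_closed hom_add hom_smult\<close>)
qed

end

lemma (in left_module) left_module_hom_id: "left_module_hom R M M (\<lambda>x. x)"
  by unfold_locales auto

context
  fixes R :: "('r, 'q) ring_scheme" and M :: "('r, 'm) module" and N :: "('r, 'n) module" and h
  assumes h: "left_module_hom R M N h"
begin

interpretation left_module_hom R M N h by (rule h)

text \<open>Injectivity on \<open>F\<close> keeps the terms apart: coefficients indexed by \<open>h ` F\<close> are the same data as
  coefficients indexed by \<open>F\<close>. The next two lemmas transport linear relations by this identity, backwards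
  and forwards along \<open>h\<close>.\<close>

lemma hom_linear_combination:
  assumes "F \<subseteq> carrier M" "inj_on h F" "c \<in> h ` F \<rightarrow> carrier R"
  shows "h (\<Oplus>\<^bsub>M\<^esub>d\<in>F. c (h d) \<odot>\<^bsub>M\<^esub> d) = (\<Oplus>\<^bsub>N\<^esub>d\<in>h ` F. c d \<odot>\<^bsub>N\<^esub> d)"
proof -
  have F: "d \<in> carrier M" "c (h d) \<in> carrier R" "h d \<in> carrier N" if "d \<in> F" for d
    using assms that hom_closed by auto
  have "h (\<Oplus>\<^bsub>M\<^esub>d\<in>F. c (h d) \<odot>\<^bsub>M\<^esub> d) = (\<Oplus>\<^bsub>N\<^esub>d\<in>F. h (c (h d) \<odot>\<^bsub>M\<^esub> d))"
    by (rule hom_finsum) (use F in auto)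
  also have "\<dots> = (\<Oplus>\<^bsub>N\<^esub>d\<in>F. c (h d) \<odot>\<^bsub>N\<^esub> h d)"
    by (rule N.M.finsum_cong') (use F in \<open>auto simp: hom_smult\<close>)
  also have "\<dots> = (\<Oplus>\<^bsub>N\<^esub>d\<in>h ` F. c d \<odot>\<^bsub>N\<^esub> d)"
    by (rule N.M.finsum_reindex[symmetric]) (use F assms(2) in auto)
  finally show ?thesis .
qed

lemma lin_independent_if_image:
  assumes "lin_independent R N (h ` D)" "inj_on h D" "D \<subseteq> carrier M"
  shows "lin_independent R M D"
  unfolding lin_independent_def
proof (intro conjI allI impI ballI)
  fix F c d
  assume F: "finite F" "F \<subseteq> D" and c: "c \<in> F \<rightarrow> carrier R"
    and rel: "(\<Oplus>\<^bsub>M\<^esub>d\<in>F. c d \<odot>\<^bsub>M\<^esub> d) = \<zero>\<^bsub>M\<^esub>" and d: "d \<in> F"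
  define c' where "c' = c \<circ> inv_into F h"
  have inj: "inj_on h F" using assms(2) F(2) by (rule inj_on_subset)
  have c'h: "c' (h d) = c d" if "d \<in> F" for d
    using that inj by (simp add: c'_def)
  then have c': "c' \<in> h ` F \<rightarrow> carrier R" using c by auto
  have "(\<Oplus>\<^bsub>M\<^esub>d\<in>F. c' (h d) \<odot>\<^bsub>M\<^esub> d) = \<zero>\<^bsub>M\<^esub>"
    unfolding rel[symmetric]
    by (rule M.M.finsum_cong') (use c'h c F assms(3) in \<open>auto simp: Pi_iff subset_iff\<close>)
  then have "(\<Oplus>\<^bsub>N\<^esub>d\<in>h ` F. c' d \<odot>\<^bsub>N\<^esub> d) = \<zero>\<^bsub>N\<^esub>"
    using hom_linear_combination[OF _ inj c'] F(2) assms(3) hom_zero by auto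
  then have "\<forall>d\<in>h ` F. c' d = \<zero>\<^bsub>R\<^esub>"
    using assms(1) F c' unfolding lin_independent_def by (meson finite_imageI image_mono)
  then show "c d = \<zero>\<^bsub>R\<^esub>" using c'h d by auto
qed (use assms(3) in auto)

lemma lin_independent_image:
  assumes "lin_independent R M D" "inj_on h (carrier M)"
  shows "lin_independent R N (h ` D)"
  unfolding lin_independent_def
proof (intro conjI allI impI ballI)
  have D: "D \<subseteq> carrier M" using assms(1) unfolding lin_independent_def by blast
  then show "h ` D \<subseteq> carrier N" using hom_closed by auto
  fix F c d
  assume F: "finite F" "F \<subseteq> h ` D" and c: "c \<in> F \<rightarrow> carrier R"
    and rel: "(\<Oplus>\<^bsub>N\<^esub>d\<in>F. c d \<odot>\<^bsub>N\<^esub> d) = \<zero>\<^bsub>N\<^esub>" and d: "d \<in> F"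
  obtain E where E: "E \<subseteq> D" "finite E" "F = h ` E"
    using F by (meson finite_subset_image)
  have inj: "inj_on h E" using assms(2) D E(1) by (meson inj_on_subset order_trans)
  let ?u = "\<Oplus>\<^bsub>M\<^esub>d\<in>E. c (h d) \<odot>\<^bsub>M\<^esub> d"
  have "h ?u = h \<zero>\<^bsub>M\<^esub>"
    using hom_linear_combination[OF _ inj] E D c rel hom_zero by auto
  moreover have "?u \<in> carrier M"
    by (rule M.M.finsum_closed) (use D E c in \<open>auto simp: Pi_iff subset_iff\<close>)
  ultimately have "?u = \<zero>\<^bsub>M\<^esub>" using assms(2) by (auto dest: inj_onD)
  moreover have "(\<lambda>d. c (h d)) \<in> E \<rightarrow> carrier R" using c E(3) by auto
  ultimately have "\<forall>d\<in>E. c (h d) = \<zero>\<^bsub>R\<^esub>"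
    using assms(1) E unfolding lin_independent_def by blast
  then show "c d = \<zero>\<^bsub>R\<^esub>" using d E(3) by auto
qed

end

section \<open>Tensor products over a noncommutative ring\<close>

text \<open>\<open>V\<close> stands for a bimodule. The commutation of its two actions, \<open>ract_smult\<close>, is what lets \<open>A\<close> act
  on the tensor product through the left factor.\<close>

locale tensor_factors = V: left_module A V + M: left_module R M
  for A :: "('a, 'p) ring_scheme" and V :: "('a, 'x) module"
    and R :: "('r, 'q) ring_scheme" and M :: "('r, 'm) module" +
  fixes ract :: "'x \<Rightarrow> 'r \<Rightarrow> 'x"
  assumes ract_closed: "\<lbrakk>x \<in> carrier V; r \<in> carrier R\<rbrakk> \<Longrightarrow> ract x r \<in> carrier V"
    and ract_smult:
      "\<lbrakk>a \<in> carrier A; x \<in> carrier V; r \<in> carrier R\<rbrakk> \<Longrightarrow>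
        ract (a \<odot>\<^bsub>V\<^esub> x) r = a \<odot>\<^bsub>V\<^esub> ract x r"
begin

abbreviation "F \<equiv> free_Abelian_group (carrier V \<times> carrier M)"
abbreviation "N \<equiv> tensor_null V ract R M"
abbreviation "T \<equiv> tensor_product V ract R M"
abbreviation "pure \<equiv> pure_tensor V ract R M"
abbreviation coset where "coset c \<equiv> N #>\<^bsub>F\<^esub> c"
abbreviation lmult where "lmult a \<equiv> frag_extend (\<lambda>(x, m). frag_of (a \<odot>\<^bsub>V\<^esub> x, m))"

sublocale F: comm_group F
  by (rule abelian_free_Abelian_group)

lemma F_add: "\<lbrakk>c \<in> carrier F; d \<in> carrier F\<rbrakk> \<Longrightarrow> c + d \<in> carrier F"
  using F.m_closed[of c d] by simp

lemma F_diff: "\<lbrakk>c \<in> carrier F; d \<in> carrier F\<rbrakk> \<Longrightarrow> c - d \<in> carrier F"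
  using F.m_closed[of c "inv\<^bsub>F\<^esub> d"] F.inv_closed[of d] by (simp del: F.inv_closed)

lemma F_induct [consumes 1, case_names zero diff of]:
  assumes "c \<in> carrier F" and "P 0"
    and "\<And>c d. \<lbrakk>c \<in> carrier F; d \<in> carrier F; P c; P d\<rbrakk> \<Longrightarrow> P (c - d)"
    and "\<And>x m. \<lbrakk>x \<in> carrier V; m \<in> carrier M\<rbrakk> \<Longrightarrow> P (frag_of (x, m))"
  shows "P c"
  using assms(1)[simplified] by (rule free_Abelian_group_induct) (use assms(2-) in auto)

lemma relation_add_left:
  "\<lbrakk>x \<in> carrier V; y \<in> carrier V; m \<in> carrier M\<rbrakk> \<Longrightarrow>
    frag_of (x \<oplus>\<^bsub>V\<^esub> y, m) - frag_of (x, m) - frag_of (y, m) \<in> tensor_relations V ract R M"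
  unfolding tensor_relations_def by blast

lemma relation_add_right:
  "\<lbrakk>x \<in> carrier V; m \<in> carrier M; n \<in> carrier M\<rbrakk> \<Longrightarrow>
    frag_of (x, m \<oplus>\<^bsub>M\<^esub> n) - frag_of (x, m) - frag_of (x, n) \<in> tensor_relations V ract R M"
  unfolding tensor_relations_def by blast

lemma relation_balanced:
  "\<lbrakk>x \<in> carrier V; r \<in> carrier R; m \<in> carrier M\<rbrakk> \<Longrightarrow>
    frag_of (ract x r, m) - frag_of (x, r \<odot>\<^bsub>M\<^esub> m) \<in> tensor_relations V ract R M"
  unfolding tensor_relations_def by blast

lemma tensor_relations_in_F: "tensor_relations V ract R M \<subseteq> carrier F"
  unfolding tensor_relations_def
  by (intro Un_least subsetI; clarsimp simp del: carrier_free_Abelian_group_iff)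
    (intro F_diff; simp add: ract_closed)+

lemma subgroup_null: "subgroup N F"
  unfolding tensor_null_def by (rule F.generate_is_subgroup) (rule tensor_relations_in_F)

lemma normal_null: "N \<lhd> F"
  using subgroup_null by (simp add: F.normal_iff_subgroup)

lemma null_in_F: "N \<subseteq> carrier F"
  using subgroup_null by (rule subgroup.subset)

lemma null_add: "\<lbrakk>c \<in> N; d \<in> N\<rbrakk> \<Longrightarrow> c + d \<in> N"
  using subgroup.m_closed[OF subgroup_null, of c d] by simp

lemma null_diff: "\<lbrakk>c \<in> N; d \<in> N\<rbrakk> \<Longrightarrow> c - d \<in> N"
  using null_add[of c "- d"] subgroup.m_inv_closed[OF subgroup_null, of d] null_in_F by auto

lemma null_zero: "0 \<in> N"
  using subgroup.one_closed[OF subgroup_null] by simp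

lemma coset_eqI:
  assumes "c \<in> carrier F" "d \<in> carrier F" "c - d \<in> N"
  shows "coset c = coset d"
proof (rule F.repr_independence[symmetric])
  show "c \<in> coset d"
    using assms(3) unfolding r_coset_def by (force intro: bexI[of _ "c - d"])
qed (use assms subgroup_null in auto)

lemma carrier_tensor: "carrier T = coset ` carrier F"
  by (simp add: tensor_product_def Let_def carrier_FactGroup)

lemma zero_tensor: "\<zero>\<^bsub>T\<^esub> = coset 0"
  using F.coset_mult_one[OF null_in_F] by (simp add: tensor_product_def Let_def FactGroup_def)

lemma add_tensor: "\<lbrakk>c \<in> carrier F; d \<in> carrier F\<rbrakk> \<Longrightarrow> coset c \<oplus>\<^bsub>T\<^esub> coset d = coset (c + d)"
  using normal.rcos_sum[OF normal_null, of c d]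
  by (simp add: tensor_product_def Let_def FactGroup_def)

lemma abelian_group_tensor: "abelian_group T"
proof (rule abelian_groupI)
  have inv: "- c \<in> carrier F" if "c \<in> carrier F" for c
    using F_diff[of 0 c] that by simp
  show "\<exists>Y\<in>carrier T. Y \<oplus>\<^bsub>T\<^esub> X = \<zero>\<^bsub>T\<^esub>" if "X \<in> carrier T" for X
  proof -
    obtain c where c: "c \<in> carrier F" "X = coset c" using \<open>X \<in> carrier T\<close> unfolding carrier_tensor by blast
    then have "coset (- c) \<oplus>\<^bsub>T\<^esub> X = \<zero>\<^bsub>T\<^esub>"
      using inv[OF c(1)] by (simp add: add_tensor zero_tensor del: carrier_free_Abelian_group_iff)
    then show ?thesis using inv[OF c(1)] unfolding carrier_tensor by blast
  qed
qed (use F_add F.one_closed in \<open>auto simp: carrier_tensor zero_tensor add_tensor algebra_simps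
      simp del: carrier_free_Abelian_group_iff\<close>)

lemma lmult_in_F: "\<lbrakk>a \<in> carrier A; c \<in> carrier F\<rbrakk> \<Longrightarrow> lmult a c \<in> carrier F"
  using keys_frag_extend[of "\<lambda>(x, m). frag_of (a \<odot>\<^bsub>V\<^esub> x, m)" c]
  by (fastforce simp: keys_frag_of)

text \<open>Relations go to relations; for the balancing relations this is the commutation of the two
  actions on \<open>V\<close>.\<close>

lemma lmult_null:
  assumes a: "a \<in> carrier A" and c: "c \<in> N"
  shows "lmult a c \<in> N"
proof -
  have rel: "lmult a r \<in> tensor_relations V ract R M" if r: "r \<in> tensor_relations V ract R M" for r
    using r[unfolded tensor_relations_def]
  proof (elim UnE CollectE exE conjE)
    fix x y m
    assume "r = frag_of (x \<oplus>\<^bsub>V\<^esub> y, m) - frag_of (x, m) - frag_of (y, m)"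
      and "x \<in> carrier V" "y \<in> carrier V" "m \<in> carrier M"
    then show ?thesis
      using a relation_add_left[of "a \<odot>\<^bsub>V\<^esub> x" "a \<odot>\<^bsub>V\<^esub> y" m]
      by (simp add: frag_extend_diff V.smult_r_distr)
  next
    fix x m n
    assume "r = frag_of (x, m \<oplus>\<^bsub>M\<^esub> n) - frag_of (x, m) - frag_of (x, n)"
      and "x \<in> carrier V" "m \<in> carrier M" "n \<in> carrier M"
    then show ?thesis
      using a relation_add_right[of "a \<odot>\<^bsub>V\<^esub> x" m n] by (simp add: frag_extend_diff)
  next
    fix x t m
    assume "r = frag_of (ract x t, m) - frag_of (x, t \<odot>\<^bsub>M\<^esub> m)"
      and "x \<in> carrier V" "t \<in> carrier R" "m \<in> carrier M"
    then show ?thesis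
      using a relation_balanced[of "a \<odot>\<^bsub>V\<^esub> x" t m] by (simp add: frag_extend_diff ract_smult)
  qed
  from c[unfolded tensor_null_def] show ?thesis
  proof (induction rule: generate.induct)
    case (incl r)
    then show ?case
      unfolding tensor_null_def using rel generate.incl by metis
  next
    case (inv r)
    then have "lmult a r \<in> N"
      unfolding tensor_null_def using rel generate.incl by metis
    then show ?case
      using null_diff[OF null_zero] inv tensor_relations_in_F
      by (auto simp: frag_extend_minus)
  qed (auto simp: null_zero null_add frag_extend_add)
qed

text \<open>The action on cosets is defined as a union over representatives; the sets in this union coincide,
  because two representatives differ by an element of \<open>N\<close>, which \<open>lmult a\<close> preserves.\<close>

lemma smult_tensor:
  assumes a: "a \<in> carrier A" and c: "c \<in> carrier F"
  shows "a \<odot>\<^bsub>T\<^esub> coset c = coset (lmult a c)"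
proof -
  have "coset (lmult a d) = coset (lmult a c)" if d: "d \<in> coset c" for d
  proof -
    obtain n where n: "n \<in> N" "d = n + c"
      using d by (auto simp: r_coset_def)
    then have "d \<in> carrier F" using null_in_F F_add c by blast
    then show ?thesis
      using n a c lmult_null by (intro coset_eqI lmult_in_F) (auto simp: frag_extend_add)
  qed
  then have "(\<Union>d\<in>coset c. coset (lmult a d)) = (\<Union>d\<in>coset c. coset (lmult a c))"
    by (intro SUP_cong refl)
  moreover have "c \<in> coset c" using c subgroup_null by (intro F.rcos_self)
  ultimately have "(\<Union>d\<in>coset c. coset (lmult a d)) = coset (lmult a c)"
    by (metis UN_constant empty_iff)
  then show ?thesis
    by (simp add: tensor_product_def Let_def)
qed

lemma left_module_tensor: "left_module A T"
proof -
  interpret T: abelian_group T by (rule abelian_group_tensor)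
  show ?thesis
  proof unfold_locales
    show "a \<odot>\<^bsub>T\<^esub> X \<in> carrier T" if "a \<in> carrier A" "X \<in> carrier T" for a X
      using that lmult_in_F unfolding carrier_tensor by (auto simp: smult_tensor)
    show "a \<odot>\<^bsub>T\<^esub> (X \<oplus>\<^bsub>T\<^esub> Y) = a \<odot>\<^bsub>T\<^esub> X \<oplus>\<^bsub>T\<^esub> a \<odot>\<^bsub>T\<^esub> Y"
      if "a \<in> carrier A" "X \<in> carrier T" "Y \<in> carrier T" for a X Y
      using that F_add lmult_in_F unfolding carrier_tensor
      by (auto simp: smult_tensor add_tensor frag_extend_add simp del: carrier_free_Abelian_group_iff)
    show "(a \<otimes>\<^bsub>A\<^esub> b) \<odot>\<^bsub>T\<^esub> X = a \<odot>\<^bsub>T\<^esub> (b \<odot>\<^bsub>T\<^esub> X)"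
      if a: "a \<in> carrier A" and b: "b \<in> carrier A" and X: "X \<in> carrier T" for a b X
    proof -
      obtain c where c: "c \<in> carrier F" "X = coset c" using X unfolding carrier_tensor by blast
      have "lmult (a \<otimes>\<^bsub>A\<^esub> b) c = lmult a (lmult b c)"
        using c(1)
        by (induction rule: F_induct)
          (auto simp: frag_extend_diff V.smult_assoc a b)
      then show ?thesis
        using a b c lmult_in_F by (simp add: smult_tensor del: carrier_free_Abelian_group_iff)
    qed
    show "\<one>\<^bsub>A\<^esub> \<odot>\<^bsub>T\<^esub> X = X" if X: "X \<in> carrier T" for X
    proof -
      obtain c where c: "c \<in> carrier F" "X = coset c" using X unfolding carrier_tensor by blast
      have "lmult \<one>\<^bsub>A\<^esub> c = c"
        using c(1)
        by (induction rule: F_induct) (auto simp: frag_extend_diff)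
      then show ?thesis
        using c by (simp add: smult_tensor del: carrier_free_Abelian_group_iff)
    qed
    show "(a \<oplus>\<^bsub>A\<^esub> b) \<odot>\<^bsub>T\<^esub> X = a \<odot>\<^bsub>T\<^esub> X \<oplus>\<^bsub>T\<^esub> b \<odot>\<^bsub>T\<^esub> X"
      if a: "a \<in> carrier A" and b: "b \<in> carrier A" and X: "X \<in> carrier T" for a b X
    proof -
      obtain c where c: "c \<in> carrier F" "X = coset c" using X unfolding carrier_tensor by blast
      have "lmult (a \<oplus>\<^bsub>A\<^esub> b) c - lmult a c - lmult b c \<in> N"
        using c(1)
      proof (induction rule: F_induct)
        case (diff c d)
        then show ?case
          using null_diff[OF diff(3,4)] by (simp add: frag_extend_diff algebra_simps)
      next
        case (of x m)
        show ?case
        proof -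
          have "frag_of (a \<odot>\<^bsub>V\<^esub> x \<oplus>\<^bsub>V\<^esub> b \<odot>\<^bsub>V\<^esub> x, m)
              - frag_of (a \<odot>\<^bsub>V\<^esub> x, m) - frag_of (b \<odot>\<^bsub>V\<^esub> x, m) \<in> N"
            unfolding tensor_null_def
            by (intro generate.incl relation_add_left V.smult_closed a b of)
          then show ?thesis using of a b by (simp add: V.smult_l_distr)
        qed
      qed (simp add: null_zero)
      then have "coset (lmult (a \<oplus>\<^bsub>A\<^esub> b) c) = coset (lmult a c + lmult b c)"
        by (intro coset_eqI) (use a b c F_add lmult_in_F in
            \<open>auto simp: algebra_simps simp del: carrier_free_Abelian_group_iff\<close>)
      then show ?thesis
        using a b c lmult_in_F by (simp add: smult_tensor add_tensor del: carrier_free_Abelian_group_iff)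
    qed
  qed
qed

sublocale T: left_module A T
  by (rule left_module_tensor)

lemma diff_tensor: "\<lbrakk>c \<in> carrier F; d \<in> carrier F\<rbrakk> \<Longrightarrow> coset c \<ominus>\<^bsub>T\<^esub> coset d = coset (c - d)"
proof -
  assume c: "c \<in> carrier F" and d: "d \<in> carrier F"
  have T: "coset c \<in> carrier T" "coset d \<in> carrier T" "coset (c - d) \<in> carrier T"
    using c d F_diff unfolding carrier_tensor by blast+
  have "coset c = coset (c - d) \<oplus>\<^bsub>T\<^esub> coset d"
    using add_tensor[OF F_diff[OF c d] d] by simp
  then show ?thesis
    using T by (simp add: a_minus_def T.M.a_assoc T.M.r_neg)
qed

lemma pure_closed [simp]: "\<lbrakk>x \<in> carrier V; m \<in> carrier M\<rbrakk> \<Longrightarrow> pure x m \<in> carrier T"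
  unfolding carrier_tensor pure_tensor_def by simp

text \<open>The pure tensors generate the tensor product as an abelian group.\<close>

lemma tensor_induct [consumes 1, case_names zero diff pure]:
  assumes X: "X \<in> carrier T" and zero: "P \<zero>\<^bsub>T\<^esub>"
    and diff: "\<And>X Y. \<lbrakk>X \<in> carrier T; Y \<in> carrier T; P X; P Y\<rbrakk> \<Longrightarrow> P (X \<ominus>\<^bsub>T\<^esub> Y)"
    and pure: "\<And>x m. \<lbrakk>x \<in> carrier V; m \<in> carrier M\<rbrakk> \<Longrightarrow> P (pure x m)"
  shows "P X"
proof -
  obtain c where c: "c \<in> carrier F" "X = coset c" using X unfolding carrier_tensor by blast
  have "P (coset c)"
    using c(1)
  proof (induction rule: F_induct)
    case (diff c d)
    then have "P (coset c \<ominus>\<^bsub>T\<^esub> coset d)"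
      by (intro assms(3)) (auto simp: carrier_tensor simp del: carrier_free_Abelian_group_iff)
    then show ?case using diff by (simp add: diff_tensor del: carrier_free_Abelian_group_iff)
  qed (use zero pure in \<open>auto simp: zero_tensor pure_tensor_def\<close>)
  then show ?thesis using c by simp
qed

lemma tensor_subset_submodule:
  assumes "submodule H A T"
    and "\<And>x m. \<lbrakk>x \<in> carrier V; m \<in> carrier M\<rbrakk> \<Longrightarrow> pure x m \<in> H"
  shows "carrier T \<subseteq> H"
proof
  fix X assume "X \<in> carrier T"
  then show "X \<in> H"
    by (induction rule: tensor_induct)
      (use assms T.submoduleD[OF assms(1)] in \<open>auto simp: a_minus_def\<close>)
qed

lemma pure_add_left:
  assumes "x \<in> carrier V" "y \<in> carrier V" "m \<in> carrier M"
  shows "pure (x \<oplus>\<^bsub>V\<^esub> y) m = pure x m \<oplus>\<^bsub>T\<^esub> pure y m"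
proof -
  let ?c = "frag_of (x \<oplus>\<^bsub>V\<^esub> y, m)" and ?d = "frag_of (x, m)" and ?e = "frag_of (y, m)"
  have F: "?c \<in> carrier F" "?d \<in> carrier F" "?e \<in> carrier F"
    using assms by auto
  have "?c - ?d - ?e \<in> N"
    unfolding tensor_null_def by (intro generate.incl relation_add_left assms)
  then have "coset ?c = coset (?d + ?e)"
    by (intro coset_eqI F F_add) (simp add: algebra_simps)
  then show ?thesis
    unfolding pure_tensor_def using F by (simp add: add_tensor del: carrier_free_Abelian_group_iff)
qed

lemma pure_add_right:
  assumes "x \<in> carrier V" "m \<in> carrier M" "n \<in> carrier M"
  shows "pure x (m \<oplus>\<^bsub>M\<^esub> n) = pure x m \<oplus>\<^bsub>T\<^esub> pure x n"
proof -
  let ?c = "frag_of (x, m \<oplus>\<^bsub>M\<^esub> n)" and ?d = "frag_of (x, m)" and ?e = "frag_of (x, n)"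
  have F: "?c \<in> carrier F" "?d \<in> carrier F" "?e \<in> carrier F"
    using assms by auto
  have "?c - ?d - ?e \<in> N"
    unfolding tensor_null_def by (intro generate.incl relation_add_right assms)
  then have "coset ?c = coset (?d + ?e)"
    by (intro coset_eqI F F_add) (simp add: algebra_simps)
  then show ?thesis
    unfolding pure_tensor_def using F by (simp add: add_tensor del: carrier_free_Abelian_group_iff)
qed

lemma pure_balanced:
  assumes "x \<in> carrier V" "r \<in> carrier R" "m \<in> carrier M"
  shows "pure (ract x r) m = pure x (r \<odot>\<^bsub>M\<^esub> m)"
proof -
  have "frag_of (ract x r, m) - frag_of (x, r \<odot>\<^bsub>M\<^esub> m) \<in> N"
    unfolding tensor_null_def by (intro generate.incl relation_balanced assms)
  then show ?thesis
    unfolding pure_tensor_def using assms ract_closed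
    by (intro coset_eqI) (auto simp del: carrier_free_Abelian_group_iff)
qed

lemma pure_smult:
  assumes "a \<in> carrier A" "x \<in> carrier V" "m \<in> carrier M"
  shows "a \<odot>\<^bsub>T\<^esub> pure x m = pure (a \<odot>\<^bsub>V\<^esub> x) m"
  unfolding pure_tensor_def using assms by (subst smult_tensor) auto

lemma tensor_hom_eqI:
  assumes g: "left_module_hom A T Q g" and h: "left_module_hom A T Q h"
    and eq: "\<And>x m. \<lbrakk>x \<in> carrier V; m \<in> carrier M\<rbrakk> \<Longrightarrow> g (pure x m) = h (pure x m)"
    and X: "X \<in> carrier T"
  shows "g X = h X"
proof -
  interpret g: left_module_hom A T Q g by (rule g)
  interpret h: left_module_hom A T Q h by (rule h)
  show ?thesis using X
    by (induction rule: tensor_induct) (auto simp: g.hom_zero h.hom_zero g.hom_diff h.hom_diff eq)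
qed

text \<open>The universal property. The map \<open>f\<close> extends to the free abelian group on the pairs; biadditivity
  and balancing say that this extension kills the relations, so that it factors through the quotient.\<close>

lemma tensor_universal:
  fixes f :: "'x \<Rightarrow> 'm \<Rightarrow> 'z"
  assumes Q: "left_module A Q"
    and closed: "\<And>x m. \<lbrakk>x \<in> carrier V; m \<in> carrier M\<rbrakk> \<Longrightarrow> f x m \<in> carrier Q"
    and add_left: "\<And>x y m. \<lbrakk>x \<in> carrier V; y \<in> carrier V; m \<in> carrier M\<rbrakk> \<Longrightarrow>
        f (x \<oplus>\<^bsub>V\<^esub> y) m = f x m \<oplus>\<^bsub>Q\<^esub> f y m"
    and add_right: "\<And>x m n. \<lbrakk>x \<in> carrier V; m \<in> carrier M; n \<in> carrier M\<rbrakk> \<Longrightarrow>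
        f x (m \<oplus>\<^bsub>M\<^esub> n) = f x m \<oplus>\<^bsub>Q\<^esub> f x n"
    and balanced: "\<And>x r m. \<lbrakk>x \<in> carrier V; r \<in> carrier R; m \<in> carrier M\<rbrakk> \<Longrightarrow>
        f (ract x r) m = f x (r \<odot>\<^bsub>M\<^esub> m)"
    and smult: "\<And>a x m. \<lbrakk>a \<in> carrier A; x \<in> carrier V; m \<in> carrier M\<rbrakk> \<Longrightarrow>
        f (a \<odot>\<^bsub>V\<^esub> x) m = a \<odot>\<^bsub>Q\<^esub> f x m"
  obtains h where "left_module_hom A T Q h"
    and "\<And>x m. \<lbrakk>x \<in> carrier V; m \<in> carrier M\<rbrakk> \<Longrightarrow> h (pure x m) = f x m"
proof -
  interpret Q: left_module A Q by (rule Q)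
  have "(\<lambda>(x, m). f x m) ` (carrier V \<times> carrier M) \<subseteq> carrier (add_monoid Q)"
    using closed by auto
  then obtain g where g: "g \<in> hom F (add_monoid Q)"
    and g_of': "\<And>p. p \<in> carrier V \<times> carrier M \<Longrightarrow> g (frag_of p) = (\<lambda>(x, m). f x m) p"
    using comm_group.free_Abelian_group_universal[OF Q.M.a_comm_group] by blast
  have g_of: "g (frag_of (x, m)) = f x m" if "x \<in> carrier V" "m \<in> carrier M" for x m
    using g_of'[of "(x, m)"] that by simp
  interpret g: group_hom F "add_monoid Q" g
    using g by unfold_locales
  have g_diff: "g (c - d) = g c \<ominus>\<^bsub>Q\<^esub> g d" if "c \<in> carrier F" "d \<in> carrier F" for c d
    using g.hom_mult[of c "inv\<^bsub>F\<^esub> d"] g.hom_inv[of d] that F.inv_closed[of d]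
    by (simp add: a_minus_def a_inv_def del: g.hom_inv F.inv_closed)
  have rearrange: "u \<oplus>\<^bsub>Q\<^esub> (v \<oplus>\<^bsub>Q\<^esub> (\<ominus>\<^bsub>Q\<^esub> u \<oplus>\<^bsub>Q\<^esub> \<ominus>\<^bsub>Q\<^esub> v)) = \<zero>\<^bsub>Q\<^esub>"
    if "u \<in> carrier Q" "v \<in> carrier Q" for u v
    using that by (metis Q.M.a_assoc Q.M.add.inv_closed Q.M.add.m_closed Q.M.minus_add Q.M.r_neg)
  have "tensor_relations V ract R M \<subseteq> kernel F (add_monoid Q) g"
  proof
    fix r assume r: "r \<in> tensor_relations V ract R M"
    then have "g r = \<zero>\<^bsub>Q\<^esub>"
      unfolding tensor_relations_def
      by (auto simp: g_diff F_diff g_of closed add_left add_right balanced ract_closed a_minus_def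
          Q.M.minus_add Q.M.a_ac Q.M.r_neg rearrange
          simp del: carrier_free_Abelian_group_iff)
    then show "r \<in> kernel F (add_monoid Q) g"
      using subsetD[OF tensor_relations_in_F r] unfolding kernel_def by simp
  qed
  then have "N \<subseteq> kernel F (add_monoid Q) g"
    unfolding tensor_null_def by (rule F.generate_subgroup_incl) (rule g.subgroup_kernel)
  then obtain h where h: "h \<in> hom (F Mod N) (add_monoid Q)"
    and h_coset: "\<And>c. c \<in> carrier F \<Longrightarrow> h (coset c) = g c"
    using g.FactGroup_universal_kernel[OF normal_null] by blast
  have h_closed: "h X \<in> carrier Q" if "X \<in> carrier T" for X
    using that h_coset g.hom_closed unfolding carrier_tensor by auto
  have h_diff: "h (X \<ominus>\<^bsub>T\<^esub> Y) = h X \<ominus>\<^bsub>Q\<^esub> h Y" if "X \<in> carrier T" "Y \<in> carrier T" for X Y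
    using that F_diff unfolding carrier_tensor
    by (auto simp: diff_tensor h_coset g_diff simp del: carrier_free_Abelian_group_iff)
  have h_pure: "h (pure x m) = f x m" if "x \<in> carrier V" "m \<in> carrier M" for x m
    unfolding pure_tensor_def using that by (simp add: h_coset g_of)
  show thesis
  proof
    show "left_module_hom A T Q h"
    proof unfold_locales
      show "h (X \<oplus>\<^bsub>T\<^esub> Y) = h X \<oplus>\<^bsub>Q\<^esub> h Y" if "X \<in> carrier T" "Y \<in> carrier T" for X Y
        using hom_mult[OF h, of X Y] that by (simp add: tensor_product_def Let_def)
      show "h (a \<odot>\<^bsub>T\<^esub> X) = a \<odot>\<^bsub>Q\<^esub> h X" if a: "a \<in> carrier A" and X: "X \<in> carrier T" for a X
        using X
      proof (induction rule: tensor_induct)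
        case zero
        have "\<zero>\<^bsub>T\<^esub> = \<zero>\<^bsub>T\<^esub> \<ominus>\<^bsub>T\<^esub> \<zero>\<^bsub>T\<^esub>"
          using T.M.r_neg[OF T.M.zero_closed] by (simp only: a_minus_def)
        then have "h \<zero>\<^bsub>T\<^esub> = h (\<zero>\<^bsub>T\<^esub> \<ominus>\<^bsub>T\<^esub> \<zero>\<^bsub>T\<^esub>)" by (rule arg_cong)
        also have "\<dots> = \<zero>\<^bsub>Q\<^esub>" by (subst h_diff) (auto simp: h_closed a_minus_def Q.M.r_neg)
        finally show ?case by (simp add: a T.smult_r_zero Q.smult_r_zero)
      next
        case (diff X Y)
        then show ?case by (simp add: a T.smult_r_diff Q.smult_r_diff h_diff h_closed)
      next
        case (pure x m)
        then show ?case by (simp add: a pure_smult h_pure smult)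
      qed
    qed (rule h_closed)
  qed (rule h_pure)
qed

end

section \<open>Globalisation of left ideals of a corner ring\<close>

lemma left_regular_simps [simp]:
  "carrier (left_regular R) = carrier R" "zero (left_regular R) = zero R"
  "add (left_regular R) = add R" "smult (left_regular R) = mult R"
  by (simp_all add: left_regular_def)

lemma left_module_left_regular:
  assumes "ring R"
  shows "left_module R (left_regular R)"
proof -
  interpret ring R by fact
  interpret L: abelian_group "left_regular R"
    by (rule abelian_groupI) (auto simp: a_assoc intro: a_comm add.l_inv_ex[simplified])
  show ?thesis
    by unfold_locales (auto simp: l_distr r_distr m_assoc)
qed

lemma left_ideal_module_simps [simp]:
  "carrier (left_ideal_module R S) = S" "zero (left_ideal_module R S) = zero R"
  "add (left_ideal_module R S) = add R" "smult (left_ideal_module R S) = mult R"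
  by (simp_all add: left_ideal_module_def)

text \<open>Through this identity, results on the globalisation of a left ideal apply to \<open>eAe\<close> itself.\<close>

lemma left_ideal_module_carrier: "left_ideal_module R (carrier R) = left_regular R"
  by (simp add: left_ideal_module_def left_regular_def)

lemma corner_simps [simp]:
  "zero (corner A e) = zero A" "add (corner A e) = add A"
  "mult (corner A e) = mult A" "one (corner A e) = e"
  by (simp_all add: corner_def)

locale idempotent_element = A: ring A for A :: "('k, 'a) module" (structure) +
  fixes e :: 'a
  assumes e_closed [simp]: "e \<in> carrier A" and e_idem [simp]: "e \<otimes> e = e"
begin

lemma carrier_corner: "x \<in> carrier (corner A e) \<longleftrightarrow> x \<in> carrier A \<and> e \<otimes> x = x \<and> x \<otimes> e = x"
proof
  assume "x \<in> carrier (corner A e)"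
  then obtain a where a: "a \<in> carrier A" "x = e \<otimes> a \<otimes> e" by (auto simp: corner_def)
  then have "e \<otimes> x = (e \<otimes> e) \<otimes> (a \<otimes> e)" "x \<otimes> e = e \<otimes> a \<otimes> (e \<otimes> e)"
    by (simp_all only: A.m_assoc A.m_closed e_closed)
  then show "x \<in> carrier A \<and> e \<otimes> x = x \<and> x \<otimes> e = x" using a by (simp add: A.m_assoc)
next
  assume "x \<in> carrier A \<and> e \<otimes> x = x \<and> x \<otimes> e = x"
  then show "x \<in> carrier (corner A e)" by (auto simp: corner_def intro!: exI[of _ x])
qed

lemma carrier_Ae: "x \<in> carrier (left_ideal_Ae A e) \<longleftrightarrow> x \<in> carrier A \<and> x \<otimes> e = x"
proof
  assume "x \<in> carrier (left_ideal_Ae A e)"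
  then obtain a where a: "a \<in> carrier A" "x = a \<otimes> e" by (auto simp: left_ideal_Ae_def)
  then have "x \<otimes> e = a \<otimes> (e \<otimes> e)" by (simp add: A.m_assoc)
  then show "x \<in> carrier A \<and> x \<otimes> e = x" using a by simp
next
  assume "x \<in> carrier A \<and> x \<otimes> e = x"
  then show "x \<in> carrier (left_ideal_Ae A e)" by (auto simp: left_ideal_Ae_def intro!: exI[of _ x])
qed

lemma Ae_simps [simp]:
  "zero (left_ideal_Ae A e) = zero A" "add (left_ideal_Ae A e) = add A"
  "smult (left_ideal_Ae A e) = mult A"
  by (simp_all add: left_ideal_Ae_def)

lemma e_in_corner [simp]: "e \<in> carrier (corner A e)"
  by (simp add: carrier_corner)

lemma e_in_Ae [simp]: "e \<in> carrier (left_ideal_Ae A e)"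
  by (simp add: carrier_Ae)

lemma ring_corner: "ring (corner A e)"
proof (rule ringI)
  show "abelian_group (corner A e)"
  proof (rule abelian_groupI)
    show "\<exists>y\<in>carrier (corner A e). y \<oplus>\<^bsub>corner A e\<^esub> x = \<zero>\<^bsub>corner A e\<^esub>"
      if "x \<in> carrier (corner A e)" for x
      using that by (intro bexI[of _ "\<ominus> x"])
        (auto simp: carrier_corner A.l_neg A.r_minus A.l_minus)
  qed (auto simp: carrier_corner A.r_distr A.l_distr A.a_assoc intro: A.a_comm)
  show "monoid (corner A e)"
    by (rule monoidI) (auto simp: carrier_corner A.m_assoc simp flip: A.m_assoc[of e])
qed (auto simp: carrier_corner A.r_distr A.l_distr)

sublocale reg: left_module A "left_regular A"
  by (rule left_module_left_regular) (rule A.ring_axioms)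

sublocale corner_reg: left_module "corner A e" "left_regular (corner A e)"
  by (rule left_module_left_regular) (rule ring_corner)

lemma submodule_Ae: "submodule (carrier (left_ideal_Ae A e)) A (left_regular A)"
  by (rule reg.submoduleI) (auto simp: carrier_Ae A.l_distr A.m_assoc)

lemma Ae_eq: "left_ideal_Ae A e = (left_regular A)\<lparr>carrier := carrier (left_ideal_Ae A e)\<rparr>"
  by (simp add: left_ideal_Ae_def left_ideal_module_def)

lemma left_module_Ae: "left_module A (left_ideal_Ae A e)"
  using reg.left_module_submodule[OF submodule_Ae] unfolding Ae_eq[symmetric] .

end

locale corner_left_ideal = idempotent_element A e
  for A :: "('k, 'a) module" (structure) and e +
  fixes S :: "'a set"
  assumes S_submodule: "submodule S (corner A e) (left_regular (corner A e))"
begin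

abbreviation "S_module \<equiv> left_ideal_module (corner A e) S"

lemma S_in_corner: "s \<in> S \<Longrightarrow> s \<in> carrier (corner A e)"
  using corner_reg.submoduleD(1)[OF S_submodule] by auto

lemma S_in_A: "s \<in> S \<Longrightarrow> s \<in> carrier A" and e_mult_S: "s \<in> S \<Longrightarrow> e \<otimes> s = s"
  using S_in_corner by (auto simp: carrier_corner)

lemma left_module_S: "left_module (corner A e) S_module"
  using corner_reg.left_module_submodule[OF S_submodule] by (simp add: left_ideal_module_def)

sublocale G: tensor_factors A "left_ideal_Ae A e" "corner A e" S_module "mult A"
  by (intro tensor_factors.intro left_module_Ae left_module_S tensor_factors_axioms.intro)
    (auto simp: carrier_Ae carrier_corner A.m_assoc)

lemma globalisation_S: "globalisation A e S_module = G.T"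
  by (simp add: globalisation_def)

lemma glob_tensor_S: "glob_tensor A e S_module = G.pure"
  by (intro ext) (simp add: glob_tensor_def)

lemma multiplication_hom:
  obtains \<mu> where "left_module_hom A G.T (left_regular A) \<mu>"
    and "\<And>x s. \<lbrakk>x \<in> carrier (left_ideal_Ae A e); s \<in> S\<rbrakk> \<Longrightarrow> \<mu> (G.pure x s) = x \<otimes> s"
  by (rule G.tensor_universal[OF reg.left_module_axioms, of "mult A"])
    (auto simp: carrier_Ae carrier_corner S_in_A A.l_distr A.r_distr A.m_assoc)

lemma pure_eq_smult:
  assumes "x \<in> carrier (left_ideal_Ae A e)" "s \<in> S"
  shows "G.pure x s = x \<odot>\<^bsub>G.T\<^esub> G.pure e s"
  using assms G.pure_smult[of x e s] by (simp add: carrier_Ae)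

text \<open>The preimage of \<open>AS\<close> contains all pure tensors, and the image contains \<open>s = \<mu> (e \<otimes> s)\<close>.\<close>

lemma image_multiplication:
  assumes hom: "left_module_hom A G.T (left_regular A) \<mu>"
    and \<mu>: "\<And>x s. \<lbrakk>x \<in> carrier (left_ideal_Ae A e); s \<in> S\<rbrakk> \<Longrightarrow> \<mu> (G.pure x s) = x \<otimes> s"
  shows "\<mu> ` carrier G.T = submodule_span A (left_regular A) S"
proof
  interpret \<mu>: left_module_hom A G.T "left_regular A" \<mu> by (rule hom)
  let ?AS = "submodule_span A (left_regular A) S"
  have "S \<subseteq> carrier (left_regular A)" using S_in_A by auto
  then have AS: "submodule ?AS A (left_regular A)"
    by (rule submodule_submodule_span[OF reg.left_module_axioms])
  have "x \<otimes> s \<in> ?AS" if "x \<in> carrier A" "s \<in> S" for x s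
    using that reg.submoduleD(5)[OF AS, of x s] by (simp add: submodule_span_base)
  then have "carrier G.T \<subseteq> {X \<in> carrier G.T. \<mu> X \<in> ?AS}"
    by (intro G.tensor_subset_submodule \<mu>.preimage_submodule AS) (auto simp: \<mu> carrier_Ae)
  then show "\<mu> ` carrier G.T \<subseteq> ?AS" by blast
  have "s \<in> \<mu> ` carrier G.T" if "s \<in> S" for s
    using that \<mu>[of e s] e_mult_S by (intro image_eqI[of _ _ "G.pure e s"]) auto
  then show "?AS \<subseteq> \<mu> ` carrier G.T"
    by (intro submodule_span_least \<mu>.image_submodule
        G.T.carrier_submodule) auto
qed

end

context idempotent_element
begin

sublocale eAe: corner_left_ideal A e "carrier (corner A e)"
  using corner_reg.carrier_submodule
  by (intro corner_left_ideal.intro idempotent_element_axioms corner_left_ideal_axioms.intro) simp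

lemma submodule_span_corner:
  "submodule_span A (left_regular A) (carrier (corner A e)) = carrier (left_ideal_Ae A e)"
proof
  show "submodule_span A (left_regular A) (carrier (corner A e)) \<subseteq> carrier (left_ideal_Ae A e)"
    by (rule submodule_span_least[OF submodule_Ae]) (auto simp: carrier_corner carrier_Ae)
  have "submodule (submodule_span A (left_regular A) (carrier (corner A e))) A (left_regular A)"
    by (rule submodule_submodule_span[OF reg.left_module_axioms]) (auto simp: carrier_corner)
  then have "x \<otimes> e \<in> submodule_span A (left_regular A) (carrier (corner A e))"
    if "x \<in> carrier A" for x
    using that reg.submoduleD(5)[of _ x e] by (simp add: submodule_span_base)
  then show "carrier (left_ideal_Ae A e) \<subseteq> submodule_span A (left_regular A) (carrier (corner A e))"
    unfolding carrier_Ae[abs_def] subset_iff carrier_Ae by metis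
qed

lemma section_hom: "left_module_hom A (left_ideal_Ae A e) eAe.G.T (\<lambda>x. eAe.G.pure x e)"
proof -
  interpret Ae: left_module A "left_ideal_Ae A e" by (rule left_module_Ae)
  show ?thesis
    by unfold_locales
      (use eAe.G.pure_add_left eAe.G.pure_smult in auto)
qed

text \<open>An element \<open>y\<close> of \<open>eAe\<close> can be moved across the tensor sign: \<open>x \<otimes> y = x \<otimes> y e = x y \<otimes> e\<close>. Hence
  \<open>X \<mapsto> \<phi> X \<otimes> e\<close> agrees with the identity on pure tensors, and so everywhere.\<close>

lemma multiplication_eAe_section:
  assumes hom: "left_module_hom A eAe.G.T (left_ideal_Ae A e) \<phi>"
    and \<phi>: "\<And>x y. \<lbrakk>x \<in> carrier (left_ideal_Ae A e); y \<in> carrier (corner A e)\<rbrakk> \<Longrightarrow>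
      \<phi> (eAe.G.pure x y) = x \<otimes> y"
  shows "x \<in> carrier (left_ideal_Ae A e) \<Longrightarrow> \<phi> (eAe.G.pure x e) = x"
    and "X \<in> carrier eAe.G.T \<Longrightarrow> eAe.G.pure (\<phi> X) e = X"
proof -
  interpret \<phi>: left_module_hom A eAe.G.T "left_ideal_Ae A e" \<phi> by (rule hom)
  interpret \<sigma>: left_module_hom A "left_ideal_Ae A e" eAe.G.T "\<lambda>x. eAe.G.pure x e"
    by (rule section_hom)
  show "\<phi> (eAe.G.pure x e) = x" if "x \<in> carrier (left_ideal_Ae A e)"
    using that by (simp add: \<phi> carrier_Ae)
  have comp: "left_module_hom A eAe.G.T eAe.G.T (\<lambda>X. eAe.G.pure (\<phi> X) e)"
    by unfold_locales
      (auto simp: \<phi>.hom_closed \<sigma>.hom_closed \<phi>.hom_add \<phi>.hom_smult \<sigma>.hom_add[simplified] \<sigma>.hom_smult[simplified])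
  have "eAe.G.pure (\<phi> (eAe.G.pure x y)) e = eAe.G.pure x y"
    if "x \<in> carrier (left_ideal_Ae A e)" "y \<in> carrier (corner A e)" for x y
    using that eAe.G.pure_balanced[of x y e] by (simp add: \<phi> carrier_corner)
  then show "eAe.G.pure (\<phi> X) e = X" if "X \<in> carrier eAe.G.T"
    using eAe.G.tensor_hom_eqI[OF comp eAe.G.T.left_module_hom_id _ that] by simp
qed

end

section \<open>Restriction of scalars\<close>

lemma left_module_restrict_scalars:
  assumes "unital_algebra K A" "left_module A M"
  shows "left_module K (restrict_scalars A M)"
proof -
  interpret unital_algebra K A by fact
  interpret M: left_module A M by fact
  have mult_one: "(k \<odot>\<^bsub>A\<^esub> \<one>\<^bsub>A\<^esub>) \<otimes>\<^bsub>A\<^esub> (l \<odot>\<^bsub>A\<^esub> \<one>\<^bsub>A\<^esub>) = (k \<otimes>\<^bsub>K\<^esub> l) \<odot>\<^bsub>A\<^esub> \<one>\<^bsub>A\<^esub>"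
    if "k \<in> carrier K" "l \<in> carrier K" for k l
    using that by (simp add: smult_mult_left smult_assoc1)
  interpret r: abelian_group "restrict_scalars A M"
    by (rule abelian_groupI)
      (auto simp: restrict_scalars_def M.M.a_assoc intro: M.M.a_comm M.M.add.l_inv_ex[simplified])
  show ?thesis
    by unfold_locales
      (auto simp: restrict_scalars_def smult_l_distr M.smult_l_distr M.smult_r_distr
        M.smult_assoc[symmetric] mult_one)
qed

lemma hom_restrict_scalars:
  assumes "unital_algebra K A" "left_module_hom A M (left_regular A) h"
  shows "left_module_hom K (restrict_scalars A M) A h"
proof -
  interpret unital_algebra K A by fact
  interpret h: left_module_hom A M "left_regular A" h by fact
  interpret left_module K "restrict_scalars A M"
    by (rule left_module_restrict_scalars) (rule assms(1), rule h.M.left_module_axioms)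
  interpret A: left_module K A by (rule is_left_module)
  show ?thesis
    by unfold_locales
      (use h.hom_closed h.hom_add h.hom_smult in \<open>auto simp: restrict_scalars_def smult_mult_left\<close>)
qed

section \<open>Bases of a left ideal and its globalisation\<close>

locale corner_left_ideal_algebra = corner_left_ideal A e S + unital_algebra K A
  for K :: "('k, 'q) ring_scheme" and A :: "('k, 'a) module" (structure) and e S
begin

sublocale KA: left_module K A
  by (rule is_left_module)

lemma algebra: "unital_algebra K A"
  by unfold_locales

text \<open>A scalar \<open>k\<close> acts on \<open>S\<close> as multiplication by the element \<open>k e\<close> of \<open>eAe\<close>. This is why left ideals of
  \<open>eAe\<close> are \<open>K\<close>-submodules, and why scalars can be moved across the tensor sign.\<close>

lemma scalar_in_corner: "k \<in> carrier K \<Longrightarrow> k \<odot>\<^bsub>A\<^esub> e \<in> carrier (corner A e)"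
  by (simp add: carrier_corner smult_mult_left smult_mult_right)

lemma scalar_mult_S: "\<lbrakk>k \<in> carrier K; s \<in> S\<rbrakk> \<Longrightarrow> (k \<odot>\<^bsub>A\<^esub> e) \<otimes>\<^bsub>A\<^esub> s = k \<odot>\<^bsub>A\<^esub> s"
  by (simp add: smult_mult_left S_in_A e_mult_S)

lemma submodule_over_K: "submodule S K A"
proof (rule KA.submoduleI)
  show "k \<odot>\<^bsub>A\<^esub> s \<in> S" if "k \<in> carrier K" "s \<in> S" for k s
    using corner_reg.submoduleD(5)[OF S_submodule scalar_in_corner[OF that(1)] that(2)]
      scalar_mult_S[OF that] by simp
qed (use S_in_A corner_reg.submoduleD(2,3)[OF S_submodule] in auto)

lemma pure_e_hom: "left_module_hom K (A\<lparr>carrier := S\<rparr>) (restrict_scalars A G.T) (G.pure e)"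
proof -
  interpret r: left_module K "restrict_scalars A G.T"
    by (rule left_module_restrict_scalars[OF algebra G.left_module_tensor])
  interpret S: left_module K "A\<lparr>carrier := S\<rparr>"
    by (rule KA.left_module_submodule[OF submodule_over_K])
  show ?thesis
  proof unfold_locales
    show "G.pure e (k \<odot>\<^bsub>A\<lparr>carrier := S\<rparr>\<^esub> s) = k \<odot>\<^bsub>restrict_scalars A G.T\<^esub> G.pure e s"
      if k: "k \<in> carrier K" and s': "s \<in> carrier (A\<lparr>carrier := S\<rparr>)" for k s
    proof -
      have s: "s \<in> S" using s' by simp
      have "G.pure e (k \<odot>\<^bsub>A\<^esub> s) = G.pure (e \<otimes>\<^bsub>A\<^esub> (k \<odot>\<^bsub>A\<^esub> e)) s"
        using G.pure_balanced[of e "k \<odot>\<^bsub>A\<^esub> e" s] scalar_in_corner[OF k] scalar_mult_S[OF k s] s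
        by simp
      also have "e \<otimes>\<^bsub>A\<^esub> (k \<odot>\<^bsub>A\<^esub> e) = (k \<odot>\<^bsub>A\<^esub> \<one>\<^bsub>A\<^esub>) \<otimes>\<^bsub>A\<^esub> e"
        using k by (simp add: smult_mult_left smult_mult_right)
      also have "G.pure \<dots> s = (k \<odot>\<^bsub>A\<^esub> \<one>\<^bsub>A\<^esub>) \<odot>\<^bsub>G.T\<^esub> G.pure e s"
        using G.pure_smult[of "k \<odot>\<^bsub>A\<^esub> \<one>\<^bsub>A\<^esub>" e s] k s by simp
      finally show ?thesis by (simp add: restrict_scalars_def)
    qed
  qed (use G.pure_add_right in \<open>auto simp: restrict_scalars_def\<close>)
qed

text \<open>Independence holds because the multiplication map inverts \<open>d \<mapsto> e \<otimes> d\<close> on \<open>D\<close>. For generation, the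
  elements \<open>s\<close> with \<open>e \<otimes> s\<close> in the generated submodule form a \<open>K\<close>-submodule of \<open>S\<close> that contains \<open>D\<close>.\<close>

lemma pure_e_basis:
  assumes D: "is_basis K (A\<lparr>carrier := S\<rparr>) D"
  shows "inj_on (G.pure e) D"
    and "lin_independent K (restrict_scalars A G.T) (G.pure e ` D)"
    and "submodule_span A G.T (G.pure e ` D) = carrier G.T"
proof -
  interpret t: left_module_hom K "A\<lparr>carrier := S\<rparr>" "restrict_scalars A G.T" "G.pure e"
    by (rule pure_e_hom)
  have DS: "D \<subseteq> S" and indep: "lin_independent K (A\<lparr>carrier := S\<rparr>) D"
    and span: "submodule_span K (A\<lparr>carrier := S\<rparr>) D = S"
    using D by (auto simp: is_basis_def lin_independent_def)
  obtain \<mu> where hom: "left_module_hom A G.T (left_regular A) \<mu>"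
    and \<mu>: "\<And>x s. \<lbrakk>x \<in> carrier (left_ideal_Ae A e); s \<in> S\<rbrakk> \<Longrightarrow> \<mu> (G.pure x s) = x \<otimes> s"
    using multiplication_hom by blast
  have \<mu>_pure: "\<mu> (G.pure e d) = d" if "d \<in> D" for d
    using \<mu>[of e d] that DS e_mult_S by auto
  show inj: "inj_on (G.pure e) D"
    using \<mu>_pure by (rule inj_on_inverseI)
  \<comment> \<open>The inclusion of \<open>S\<close> into \<open>A\<close> carries the independence of \<open>D\<close> over to the codomain of \<open>\<mu>\<close>.\<close>
  have "lin_independent K A ((\<lambda>x. x) ` D)"
    by (rule lin_independent_image[OF _ indep])
      (auto intro!: left_module_hom.hom_restrict[OF KA.left_module_hom_id] submodule_over_K)
  then have "lin_independent K A (\<mu> ` G.pure e ` D)"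
    using \<mu>_pure by (simp add: image_image cong: image_cong)
  then show "lin_independent K (restrict_scalars A G.T) (G.pure e ` D)"
    by (rule lin_independent_if_image[OF hom_restrict_scalars[OF algebra hom]])
      (use \<mu>_pure DS t.hom_closed in \<open>auto intro!: inj_onI\<close>)
  let ?H = "submodule_span A G.T (G.pure e ` D)"
  have D_T: "G.pure e ` D \<subseteq> carrier G.T" using DS by auto
  have H: "submodule ?H A G.T"
    by (rule submodule_submodule_span[OF G.left_module_tensor D_T])
  note H' = G.T.submoduleD[OF H]
  have "submodule ?H K (restrict_scalars A G.T)"
    by (rule t.N.submoduleI) (use H' in \<open>auto simp: restrict_scalars_def\<close>)
  then have "submodule {s \<in> carrier (A\<lparr>carrier := S\<rparr>). G.pure e s \<in> ?H} K (A\<lparr>carrier := S\<rparr>)"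
    by (rule t.preimage_submodule)
  moreover have "D \<subseteq> {s \<in> carrier (A\<lparr>carrier := S\<rparr>). G.pure e s \<in> ?H}"
    using DS by (auto intro: submodule_span_base)
  ultimately have "submodule_span K (A\<lparr>carrier := S\<rparr>) D
      \<subseteq> {s \<in> carrier (A\<lparr>carrier := S\<rparr>). G.pure e s \<in> ?H}"
    by (rule submodule_span_least)
  then have e_S: "G.pure e s \<in> ?H" if "s \<in> S" for s
    using that span by auto
  have "G.pure x s \<in> ?H" if "x \<in> carrier (left_ideal_Ae A e)" "s \<in> S" for x s
    using that pure_eq_smult[OF that] H'(5) e_S carrier_Ae by auto
  then have "carrier G.T \<subseteq> ?H"
    using H by (intro G.tensor_subset_submodule) auto
  then show "?H = carrier G.T" using H'(1) by blast
qed

end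

theorem proposition2p3p1:
  fixes K :: "('k, 'q) ring_scheme" and A :: "('k, 'a) module" and e :: 'a
    and S D :: "'a set"
  assumes "unital_algebra K A"
    and "e \<in> carrier A" and "e \<otimes>\<^bsub>A\<^esub> e = e"
    and "submodule S (corner A e) (left_regular (corner A e))"
    and "is_basis K (A\<lparr>carrier := S\<rparr>) D"
  shows "let S' = left_ideal_module (corner A e) S;
             GS = globalisation A e S';
             eAe = left_regular (corner A e);
             GeAe = globalisation A e eAe;
             Ae = left_ideal_Ae A e;
             AS = generated_left_ideal A S
         in inj_on (glob_tensor A e S' e) D \<and>
            lin_independent K (restrict_scalars A GS) (glob_tensor A e S' e ` D) \<and>
            submodule_span A GS (glob_tensor A e S' e ` D) = carrier GS \<and>
            (\<exists>\<mu> \<phi> \<iota>.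
               left_module_hom A GS AS \<mu> \<and>
               (\<forall>a\<in>carrier A. \<forall>s\<in>S. \<mu> (glob_tensor A e S' (a \<otimes>\<^bsub>A\<^esub> e) s) = a \<otimes>\<^bsub>A\<^esub> e \<otimes>\<^bsub>A\<^esub> s) \<and>
               \<mu> ` carrier GS = carrier AS \<and>
               left_module_hom A AS GeAe \<iota> \<and>
               inj_on \<iota> (carrier AS) \<and>
               (\<forall>x\<in>carrier AS. \<phi> (\<iota> x) = x) \<and>
               left_module_hom A GeAe Ae \<phi> \<and>
               (\<forall>a\<in>carrier A. \<forall>x\<in>carrier eAe.
                  \<phi> (glob_tensor A e eAe (a \<otimes>\<^bsub>A\<^esub> e) x) = a \<otimes>\<^bsub>A\<^esub> e \<otimes>\<^bsub>A\<^esub> x) \<and>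
               bij_betw \<phi> (carrier GeAe) (carrier Ae) \<and>
               left_module_hom A Ae (left_regular A) (\<lambda>x. x))"
proof -
  interpret corner_left_ideal_algebra K A e S
    using assms(1-4) unital_algebra.axioms(2)[OF assms(1)]
    by (intro corner_left_ideal_algebra.intro corner_left_ideal.intro idempotent_element.intro
        idempotent_element_axioms.intro corner_left_ideal_axioms.intro)
  let ?Ae = "left_ideal_Ae A e" and ?AS = "generated_left_ideal A S"
  have AS: "submodule (carrier ?AS) A (left_regular A)"
    using submodule_submodule_span[OF reg.left_module_axioms, of S] S_in_A
    by (auto simp: generated_left_ideal_def)
  have AS_eq: "?AS = (left_regular A)\<lparr>carrier := carrier ?AS\<rparr>"
    by (simp add: generated_left_ideal_def left_ideal_module_def)
  have AS_Ae: "carrier ?AS \<subseteq> carrier ?Ae"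
    unfolding generated_left_ideal_def left_ideal_module_simps
    by (rule submodule_span_least[OF submodule_Ae])
      (use S_in_corner in \<open>auto simp: carrier_corner carrier_Ae\<close>)
  have a_e: "a \<otimes>\<^bsub>A\<^esub> e \<in> carrier ?Ae" if "a \<in> carrier A" for a
    using that by (auto simp: left_ideal_Ae_def)

  obtain \<mu> where \<mu>_hom: "left_module_hom A G.T (left_regular A) \<mu>"
    and \<mu>: "\<And>x s. \<lbrakk>x \<in> carrier ?Ae; s \<in> S\<rbrakk> \<Longrightarrow> \<mu> (G.pure x s) = x \<otimes>\<^bsub>A\<^esub> s"
    using multiplication_hom by blast
  have \<mu>_image: "\<mu> ` carrier G.T = carrier ?AS"
    using image_multiplication[OF \<mu>_hom \<mu>] by (simp add: generated_left_ideal_def)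
  have \<mu>_AS: "left_module_hom A G.T ?AS \<mu>"
    using left_module_hom.hom_into_submodule[OF \<mu>_hom AS] \<mu>_image by (simp flip: AS_eq)

  obtain \<phi> where \<phi>_hom: "left_module_hom A eAe.G.T (left_regular A) \<phi>"
    and \<phi>: "\<And>x y. \<lbrakk>x \<in> carrier ?Ae; y \<in> carrier (corner A e)\<rbrakk> \<Longrightarrow>
      \<phi> (eAe.G.pure x y) = x \<otimes>\<^bsub>A\<^esub> y"
    using eAe.multiplication_hom by blast
  have \<phi>_image: "\<phi> ` carrier eAe.G.T = carrier ?Ae"
    using eAe.image_multiplication[OF \<phi>_hom \<phi>] by (simp add: submodule_span_corner)
  have \<phi>_Ae: "left_module_hom A eAe.G.T ?Ae \<phi>"
    using left_module_hom.hom_into_submodule[OF \<phi>_hom submodule_Ae] \<phi>_image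
    by (simp flip: Ae_eq)
  have retraction: "\<phi> (eAe.G.pure x e) = x" if "x \<in> carrier ?Ae" for x
    using \<phi>_Ae \<phi> that by (rule multiplication_eAe_section)
  have "eAe.G.pure (\<phi> X) e = X" if "X \<in> carrier eAe.G.T" for X
    using \<phi>_Ae \<phi> that by (rule multiplication_eAe_section)
  then have "inj_on \<phi> (carrier eAe.G.T)"
    by (rule inj_on_inverseI[where g = "\<lambda>x. eAe.G.pure x e"])
  then have \<phi>_bij: "bij_betw \<phi> (carrier eAe.G.T) (carrier ?Ae)"
    using \<phi>_image by (simp add: bij_betw_def)

  define \<iota> where "\<iota> x = eAe.G.pure x e" for x
  have \<phi>\<iota>: "\<phi> (\<iota> x) = x" if "x \<in> carrier ?AS" for x
    using that retraction AS_Ae by (auto simp: \<iota>_def)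
  have \<iota>_hom: "left_module_hom A ?AS eAe.G.T \<iota>"
  proof -
    have "submodule (carrier ?AS) A ?Ae"
      using reg.submoduleD[OF AS] AS_Ae by (intro left_module.submoduleI[OF left_module_Ae]) auto
    from left_module_hom.hom_restrict[OF section_hom this] show ?thesis
      by (simp add: \<iota>_def[abs_def] left_ideal_Ae_def generated_left_ideal_def left_ideal_module_def)
  qed
  have incl: "left_module_hom A ?Ae (left_regular A) (\<lambda>x. x)"
    using left_module_hom.hom_restrict[OF reg.left_module_hom_id submodule_Ae]
    by (simp flip: Ae_eq)
  show ?thesis
    unfolding Let_def left_ideal_module_carrier[of "corner A e", symmetric] globalisation_S glob_tensor_S
      eAe.globalisation_S eAe.glob_tensor_S
  proof (intro conjI exI ballI)
    show "left_module_hom A G.T ?AS \<mu>" "\<mu> ` carrier G.T = carrier ?AS"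
      and "left_module_hom A ?AS eAe.G.T \<iota>" "left_module_hom A eAe.G.T ?Ae \<phi>"
      and "bij_betw \<phi> (carrier eAe.G.T) (carrier ?Ae)"
      and "left_module_hom A ?Ae (left_regular A) (\<lambda>x. x)"
      by fact+
    show "inj_on (G.pure e) D" "lin_independent K (restrict_scalars A G.T) (G.pure e ` D)"
      and "submodule_span A G.T (G.pure e ` D) = carrier G.T"
      by (rule pure_e_basis[OF assms(5)])+
    show "\<mu> (G.pure (a \<otimes>\<^bsub>A\<^esub> e) s) = a \<otimes>\<^bsub>A\<^esub> e \<otimes>\<^bsub>A\<^esub> s" if "a \<in> carrier A" "s \<in> S" for a s
      using a_e[OF that(1)] that(2) by (rule \<mu>)
    show "\<phi> (eAe.G.pure (a \<otimes>\<^bsub>A\<^esub> e) x) = a \<otimes>\<^bsub>A\<^esub> e \<otimes>\<^bsub>A\<^esub> x"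
      if "a \<in> carrier A" "x \<in> carrier eAe.S_module" for a x
      using a_e[OF that(1)] that(2) by (intro \<phi>) simp_all
    show "inj_on \<iota> (carrier ?AS)" using \<phi>\<iota> by (rule inj_on_inverseI)
    show "\<phi> (\<iota> x) = x" if "x \<in> carrier ?AS" for x using that by (rule \<phi>\<iota>)
  qed
qed

end
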